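(* For all positive integers $n \ge d \ge 2$ there exists a collection $\mathcal{A} \subset \mathcal{P}([n]^d)$ with $|\mathcal{A}| = |\mathcal{P}([n]^d)|/2$ such that there is no pair $(A,B) \in \mathcal{A} \times \mathcal{A}$ satisfying $A \,\Delta\, B = S^d$ for some non-empty subset $S \subset [n]$ that can be written as a union of at most $\lfloor d/2 \rfloor$ intervals.
   Context: $[n]=\{1,\dots,n\}$; for integers $a \le b$, $[a,b]=\{a,a+1,\dots,b\}$ is called an interval. $\mathcal{P}(X)$ denotes the power set of $X$, $A\,\Delta\, B$ the symmetric difference, and $S^d = S\times\dots\times S \subset [n]^d$ ($d$ factors). *)

theory Defs
  imports Complex_Main "HOL-Library.FuncSet"
begin

text \<open>The d-fold Cartesian power of S: d-tuples are extensional functions on the index set {1..d}.\<close>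

definition cart_power :: "nat set \<Rightarrow> nat \<Rightarrow> (nat \<Rightarrow> nat) set" where
  "cart_power S d = ({1..d} \<rightarrow>\<^sub>E S)"

definition int_interval :: "nat set \<Rightarrow> bool" where
  "int_interval I \<longleftrightarrow> (\<exists>a b. a \<le> b \<and> I = {a..b})"

definition union_of_at_most_intervals :: "nat \<Rightarrow> nat set \<Rightarrow> bool" where
  "union_of_at_most_intervals k S \<longleftrightarrow>
     (\<exists>\<I>. finite \<I> \<and> card \<I> \<le> k \<and> (\<forall>I\<in>\<I>. int_interval I) \<and> S = \<Union>\<I>)"

end

theory Submission
  imports Defs
begin

text \<open>It suffices to find \<open>W \<subseteq> [n]\<^sup>d\<close> meeting \<open>S\<^sup>d\<close> in an odd number of points for every
  admissible \<open>S\<close>: then the sets \<open>A\<close> with \<open>\<bar>A \<inter> W\<bar>\<close> even form the required family. Grouping tuples by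
  their image, the functions \<open>S \<mapsto> \<bar>W \<inter> S\<^sup>d\<bar> mod 2\<close> are exactly the polynomials of degree at most
  \<open>d\<close> over the two-element field, without constant term, in the indicator variables \<open>x\<^sub>i\<close> of \<open>S\<close>.
  The maximal intervals of \<open>S\<close> correspond to their left endpoints, detected by the quadratic
  polynomials \<open>y\<^sub>i = x\<^sub>i (1 - x\<^sub>i\<^sub>-\<^sub>1)\<close>. The sum of the elementary symmetric polynomials
  \<open>e\<^sub>1, \<dots>, e\<^sub>k\<close> in the \<open>y\<^sub>i\<close>, where \<open>k = \<lfloor>d/2\<rfloor>\<close>, has degree at most \<open>2k \<le> d\<close>, and it counts the
  non-empty sets of at most \<open>k\<close> left endpoints. If \<open>S\<close> has \<open>m\<close> left endpoints with
  \<open>1 \<le> m \<le> k\<close>, this number is \<open>2\<^sup>m - 1\<close>, which is odd.\<close>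

lemma exists_tuple_with_image:
  assumes "finite T" "T \<noteq> {}" "card T \<le> d"
  shows "\<exists>w. w \<in> extensional {1..d} \<and> w ` {1..d} = T"
proof -
  obtain g where g: "g ` T \<subseteq> {1..d}" "inj_on g T"
    using card_le_inj[of T "{1..d}"] assms by auto
  obtain t where t: "t \<in> T" using assms by auto
  \<comment> \<open>\<open>g\<close> gives each element of \<open>T\<close> its own coordinate; the
    remaining coordinates repeat \<open>t\<close>.\<close>
  define w where "w = restrict (\<lambda>i. if i \<in> g ` T then inv_into T g i else t) {1..d}"
  have "w ` {1..d} \<subseteq> T"
    using t by (auto simp: w_def inv_into_into)
  moreover have "T \<subseteq> w ` {1..d}"
  proof
    fix s assume s: "s \<in> T"
    then have "g s \<in> {1..d}" using g by blast
    moreover have "w (g s) = s"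
      using s g \<open>g s \<in> {1..d}\<close> unfolding w_def by (simp add: inv_into_f_f)
    ultimately show "s \<in> w ` {1..d}" by force
  qed
  moreover have "w \<in> extensional {1..d}" by (simp add: w_def)
  ultimately show ?thesis by blast
qed

lemma mem_cart_power_iff:
  "w \<in> cart_power S d \<longleftrightarrow> w \<in> extensional {1..d} \<and> w ` {1..d} \<subseteq> S"
  by (auto simp: cart_power_def PiE_def)

lemma finite_cart_power: "finite S \<Longrightarrow> finite (cart_power S d)"
  by (simp add: cart_power_def finite_PiE)

text \<open>The index set \<open>X\<close> lists the monomials of a polynomial, \<open>h p\<close> being the set of variables
  of the monomial \<open>p\<close>.\<close>

lemma exists_tuples_with_parity:
  assumes "finite X" and h: "\<forall>p\<in>X. h p \<noteq> {} \<and> card (h p) \<le> d"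
    and N: "finite N"
  shows "\<exists>W\<subseteq>cart_power N d. \<forall>S\<subseteq>N.
    odd (card (W \<inter> cart_power S d)) \<longleftrightarrow> odd (card {p\<in>X. h p \<subseteq> S})"
proof -
  define c where "c T = card {p\<in>X. h p = T}" for T
  \<comment> \<open>Indicator variables are idempotent, so monomials with the same variable set
    \<open>T\<close> merge; modulo 2 only those of odd multiplicity \<open>c T\<close>
    survive.\<close>
  define Q where "Q S = {T. T \<subseteq> S \<and> odd (c T)}" for S
  have "\<exists>w. w \<in> extensional {1..d} \<and> w ` {1..d} = T" if "T \<in> Q N" for T
  proof -
    have "{p\<in>X. h p = T} \<noteq> {}"
      using that by (metis (mono_tags) Q_def c_def card.empty even_zero mem_Collect_eq)
    then have "T \<noteq> {}" "card T \<le> d" using h by auto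
    moreover have "finite T" using that N finite_subset by (auto simp: Q_def)
    ultimately show ?thesis by (rule exists_tuple_with_image[rotated 1])
  qed
  then obtain enc where enc: "\<And>T. T \<in> Q N \<Longrightarrow> enc T \<in> extensional {1..d} \<and> enc T ` {1..d} = T"
    by metis
  show ?thesis
  proof (intro exI[of _ "enc ` Q N"] conjI allI impI)
    show "enc ` Q N \<subseteq> cart_power N d"
      using enc by (auto simp: mem_cart_power_iff Q_def)
  next
    fix S assume S: "S \<subseteq> N"
    have fS: "finite S" using S N finite_subset by auto
    \<comment> \<open>As \<open>enc T\<close> has image \<open>T\<close>, it lies in
      \<open>cart_power S d\<close> exactly when \<open>T \<subseteq> S\<close>.\<close>
    have "enc ` Q N \<inter> cart_power S d = enc ` Q S"
    proof (intro set_eqI iffI)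
      fix w assume "w \<in> enc ` Q N \<inter> cart_power S d"
      then obtain T where T: "T \<in> Q N" "w = enc T" "w ` {1..d} \<subseteq> S"
        by (auto simp: mem_cart_power_iff)
      then have "T \<subseteq> S" using enc by blast
      then show "w \<in> enc ` Q S" using T by (auto simp: Q_def)
    next
      fix w assume "w \<in> enc ` Q S"
      then obtain T where T: "T \<in> Q S" "w = enc T" by auto
      then have "T \<in> Q N" using S by (auto simp: Q_def)
      then show "w \<in> enc ` Q N \<inter> cart_power S d"
        using T enc[of T] by (auto simp: mem_cart_power_iff Q_def)
    qed
    moreover have "inj_on enc (Q S)"
      by (rule inj_on_inverseI[where g = "\<lambda>w. w ` {1..d}"]) (use enc S in \<open>auto simp: Q_def\<close>)
    ultimately have "card (enc ` Q N \<inter> cart_power S d) = card (Q S)"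
      by (simp add: card_image)
    moreover have "{p\<in>X. h p \<subseteq> S} = (\<Union>T\<in>Pow S. {p\<in>X. h p = T})" by auto
    then have "card {p\<in>X. h p \<subseteq> S} = (\<Sum>T\<in>Pow S. c T)"
      unfolding c_def using \<open>finite X\<close> fS by (simp only:) (subst card_UN_disjoint, auto)
    moreover have "even (\<Sum>T\<in>Pow S. c T) \<longleftrightarrow> even (card (Q S))"
      using fS by (subst even_sum_iff) (auto simp: Q_def)
    ultimately show "odd (card (enc ` Q N \<inter> cart_power S d)) \<longleftrightarrow> odd (card {p\<in>X. h p \<subseteq> S})"
      by simp
  qed
qed

text \<open>Truncated subtraction gives \<open>0 - 1 = 0\<close>, so 0 is never a left endpoint;
  this is harmless for subsets of \<open>{1..n}\<close>.\<close>

definition left_endpoints :: "nat set \<Rightarrow> nat set" where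
  "left_endpoints S = {i\<in>S. i - 1 \<notin> S}"

text \<open>The predecessor of a left endpoint lies outside \<open>S\<close>, so the endpoint is the
  minimum of any interval of the union containing it.\<close>

lemma card_left_endpoints_le:
  assumes "union_of_at_most_intervals k S"
  shows "card (left_endpoints S) \<le> k"
proof -
  obtain F where F: "finite F" "card F \<le> k" "\<And>I. I \<in> F \<Longrightarrow> int_interval I" "S = \<Union>F"
    using assms unfolding union_of_at_most_intervals_def by blast
  have "left_endpoints S \<subseteq> Min ` F"
  proof
    fix i assume "i \<in> left_endpoints S"
    then have i: "i \<in> S" "i - 1 \<notin> S" by (auto simp: left_endpoints_def)
    then obtain I where I: "I \<in> F" "i \<in> I" using F by auto
    then obtain a b where ab: "a \<le> b" "I = {a..b}"
      using F(3) unfolding int_interval_def by blast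
    have "i - 1 \<notin> I" using i I F by auto
    then have "i = a" using I ab by auto
    moreover have "Min I = a" using ab by (auto intro: Min_eqI)
    ultimately show "i \<in> Min ` F" using I by blast
  qed
  then have "card (left_endpoints S) \<le> card F"
    using F(1) by (meson card_image_le card_mono finite_imageI le_trans)
  then show ?thesis using F(2) by simp
qed

lemma left_endpoints_nonempty:
  assumes "finite S" "S \<noteq> {}" "0 \<notin> S"
  shows "left_endpoints S \<noteq> {}"
proof -
  have "Min S \<in> S" using assms by simp
  then have "Min S > 0" using assms by (metis gr0I)
  then have "Min S - 1 \<notin> S"
    using Min_le[OF assms(1), of "Min S - 1"] by linarith
  then show ?thesis using \<open>Min S \<in> S\<close> by (auto simp: left_endpoints_def)
qed

text \<open>The pairs \<open>(J, K)\<close> index the monomials in the expansion of the product of the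
  \<open>x\<^sub>i (1 - x\<^sub>i\<^sub>-\<^sub>1)\<close>, \<open>i \<in> J\<close>, the set \<open>K\<close> consisting of those \<open>i\<close> for which \<open>x\<^sub>i\<^sub>-\<^sub>1\<close> is picked.\<close>

lemma odd_card_monomials:
  fixes S N :: "nat set"
  assumes "finite N" "S \<subseteq> N" "S \<noteq> {}" "0 \<notin> S" "card (left_endpoints S) \<le> k"
  shows "odd (card {p \<in> Sigma {J. J \<subseteq> N \<and> J \<noteq> {} \<and> card J \<le> k} Pow.
                      fst p \<union> (\<lambda>i. i - 1) ` snd p \<subseteq> S})"
    (is "odd (card ?M)")
proof -
  let ?Js = "{J. J \<subseteq> S \<and> J \<noteq> {} \<and> card J \<le> k}"
  have fS: "finite S" using assms finite_subset by auto
  have fJs: "finite ?Js" using fS by simp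
  have fJ: "finite J" if "J \<subseteq> S" for J using fS that finite_subset by auto
  have "?M = (SIGMA J:?Js. Pow {i\<in>J. i - 1 \<in> S})"
    using assms(2) by auto
  then have "card ?M = (\<Sum>J\<in>?Js. card (Pow {i\<in>J. i - 1 \<in> S}))"
    using fJs fJ by (simp add: card_SigmaI)
  then have "even (card ?M) \<longleftrightarrow> even (card {J\<in>?Js. odd (card (Pow {i\<in>J. i - 1 \<in> S}))})"
    using fJs by (simp only: even_sum_iff)
  \<comment> \<open>A power set has odd size only over the empty set, so the choices of
    \<open>K\<close> cancel modulo 2 unless \<open>J\<close> consists of left endpoints.\<close>
  moreover have "odd (card (Pow {i\<in>J. i - 1 \<in> S})) \<longleftrightarrow> J \<subseteq> left_endpoints S" if "J \<subseteq> S" for J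
    using fJ[OF that] that by (auto simp: card_Pow left_endpoints_def)
  then have "{J\<in>?Js. odd (card (Pow {i\<in>J. i - 1 \<in> S}))} =
      {J. J \<subseteq> left_endpoints S \<and> J \<noteq> {} \<and> card J \<le> k}"
    by (auto simp: left_endpoints_def)
  moreover have fL: "finite (left_endpoints S)"
    using fS by (simp add: left_endpoints_def)
  have "{J. J \<subseteq> left_endpoints S \<and> J \<noteq> {} \<and> card J \<le> k} = Pow (left_endpoints S) - {{}}"
    using fL assms(5) by (auto dest: card_mono[OF fL])
  moreover have "card (Pow (left_endpoints S) - {{}}) = 2 ^ card (left_endpoints S) - 1"
    using fL by (simp add: card_Pow)
  moreover have "odd ((2::nat) ^ card (left_endpoints S) - 1)"
    using left_endpoints_nonempty[OF fS assms(3,4)] fL by simp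
  ultimately show ?thesis by simp
qed

lemma even_card_sym_diff:
  assumes "finite A" "finite B"
  shows "even (card (sym_diff A B)) \<longleftrightarrow> even (card A + card B)"
proof -
  have "card A = card (A - B) + card (A \<inter> B)" "card B = card (B - A) + card (A \<inter> B)"
    using assms card_Int_Diff[of A B] card_Int_Diff[of B A] by (simp_all add: Int_commute)
  moreover have "card (sym_diff A B) = card (A - B) + card (B - A)"
    using assms by (intro card_Un_disjoint) auto
  ultimately show ?thesis by auto
qed

text \<open>Toggling a fixed \<open>w \<in> W\<close> is an involution on \<open>Pow U\<close> that
  flips the parity of the intersection with \<open>W\<close>.\<close>

lemma card_even_intersection:
  assumes "finite U" "W \<subseteq> U" "W \<noteq> {}"
  shows "2 * card {A \<in> Pow U. even (card (A \<inter> W))} = card (Pow U)"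
proof -
  obtain w where w: "w \<in> W" using assms by auto
  let ?E = "{A \<in> Pow U. even (card (A \<inter> W))}" and ?O = "{A \<in> Pow U. odd (card (A \<inter> W))}"
  let ?t = "\<lambda>A. sym_diff A {w}"
  have fW: "finite W" using assms finite_subset by auto
  have flip: "even (card (?t A \<inter> W)) \<longleftrightarrow> odd (card (A \<inter> W))" for A
  proof -
    have "?t A \<inter> W = sym_diff (A \<inter> W) {w}" using w by auto
    then show ?thesis using fW even_card_sym_diff[of "A \<inter> W" "{w}"] by simp
  qed
  have sub: "?t A \<in> Pow U" if "A \<in> Pow U" for A
    using that w assms by auto
  have invol: "?t (?t A) = A" for A by auto
  have "bij_betw ?t ?E ?O"
    by (rule bij_betw_byWitness[where f' = ?t]) (use flip sub invol in auto)
  then have "card ?E = card ?O" by (rule bij_betw_same_card)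
  moreover have "card (Pow U) = card ?E + card ?O"
    using assms by (subst card_Un_disjoint[symmetric]) (auto intro: arg_cong[where f = card])
  ultimately show ?thesis by simp
qed

theorem theorem1p3:
  fixes n d :: nat
  assumes "d \<ge> 2" and "n \<ge> d"
  shows "\<exists>\<A>. \<A> \<subseteq> Pow (cart_power {1..n} d) \<and>
           real (card \<A>) = real (card (Pow (cart_power {1..n} d))) / 2 \<and>
           \<not> (\<exists>(A, B) \<in> \<A> \<times> \<A>. \<exists>S. S \<noteq> {} \<and> S \<subseteq> {1..n} \<and>
                 union_of_at_most_intervals (d div 2) S \<and>
                 sym_diff A B = cart_power S d)"
proof -
  let ?N = "{1..n}" and ?k = "d div 2"
  let ?U = "cart_power ?N d"
  let ?X = "Sigma {J. J \<subseteq> ?N \<and> J \<noteq> {} \<and> card J \<le> ?k} Pow"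
  let ?h = "\<lambda>p. fst p \<union> (\<lambda>i. i - 1) ` snd p"
  have finX: "finite ?X"
    by (rule finite_subset[of _ "Pow ?N \<times> Pow ?N"]) auto
  have h: "\<forall>p\<in>?X. ?h p \<noteq> {} \<and> card (?h p) \<le> d"
  proof
    fix p assume "p \<in> ?X"
    then obtain J K where p: "p = (J, K)"
      and JK: "J \<subseteq> ?N" "J \<noteq> {}" "card J \<le> ?k" "K \<subseteq> J" by auto
    have f: "finite J" "finite K" using JK finite_subset finite_atLeastAtMost by metis+
    have "card (?h p) \<le> card J + card ((\<lambda>i. i - 1) ` K)"
      unfolding p by (simp add: card_Un_le)
    also have "\<dots> \<le> card J + card J"
      using f JK by (meson add_left_mono card_image_le card_mono le_trans)
    also have "\<dots> \<le> d" using JK by simp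
    finally show "?h p \<noteq> {} \<and> card (?h p) \<le> d" using JK p by simp
  qed
  obtain W where W: "W \<subseteq> ?U"
    and parity: "\<forall>S\<subseteq>?N. odd (card (W \<inter> cart_power S d)) \<longleftrightarrow> odd (card {p\<in>?X. ?h p \<subseteq> S})"
    using exists_tuples_with_parity[of ?X ?h d ?N, OF finX h finite_atLeastAtMost]
    by (elim exE conjE) (rule that)
  have oddW: "odd (card (W \<inter> cart_power S d))"
    if "S \<noteq> {}" "S \<subseteq> ?N" "union_of_at_most_intervals ?k S" for S
  proof -
    have "0 \<notin> S" using that(2) by auto
    from odd_card_monomials[OF finite_atLeastAtMost that(2,1) this card_left_endpoints_le[OF that(3)]]
    show ?thesis using parity that(2) by (simp only: simp_thms)
  qed
  have finU: "finite ?U" by (simp add: finite_cart_power)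
  have finW: "finite W" using W finU finite_subset by auto
  \<comment> \<open>Since \<open>d \<ge> 2\<close>, the set \<open>{1}\<close> is admissible, and
    the odd count for it shows that \<open>W\<close> is non-empty.\<close>
  have "int_interval {1}"
    unfolding int_interval_def by (intro exI[of _ 1]) simp
  then have "union_of_at_most_intervals ?k {1}"
    unfolding union_of_at_most_intervals_def
    by (intro exI[of _ "{{1}}"]) (use assms in auto)
  then have "odd (card (W \<inter> cart_power {1} d))"
    using assms by (intro oddW) auto
  then have "W \<noteq> {}" by auto
  define \<A> where "\<A> = {A \<in> Pow ?U. even (card (A \<inter> W))}"
  have "2 * card \<A> = card (Pow ?U)"
    unfolding \<A>_def by (rule card_even_intersection[OF finU W \<open>W \<noteq> {}\<close>])
  then have "real (card \<A>) = real (card (Pow ?U)) / 2"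
    by (metis nonzero_mult_div_cancel_left of_nat_mult of_nat_numeral zero_neq_numeral)
  moreover have False
    if "A \<in> \<A>" "B \<in> \<A>" "S \<noteq> {}" "S \<subseteq> ?N" "union_of_at_most_intervals ?k S"
      "sym_diff A B = cart_power S d" for A B S
  proof -
    \<comment> \<open>The symmetric difference of two sets of even size has even size, against
      \<open>oddW\<close>.\<close>
    have "W \<inter> cart_power S d = sym_diff (A \<inter> W) (B \<inter> W)"
      unfolding that(6)[symmetric] by auto
    then have "even (card (W \<inter> cart_power S d))"
      using that(1,2) finW by (simp add: even_card_sym_diff \<A>_def)
    then show False using oddW that by blast
  qed
  moreover have "\<A> \<subseteq> Pow ?U" by (auto simp: \<A>_def)
  ultimately show ?thesis by (intro exI[of _ \<A>]) blast
qed

end
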